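(* Let $G$ be a finite non-abelian AC-group, and let $X_1,\dots,X_n$ be the distinct centralizers of non-central elements of $G$. Then the commuting graph of $G$ is the disjoint union of complete graphs $$\Gamma_G = \bigsqcup_{i=1}^{n} K_{|X_i|-|Z(G)|}.$$
   Context: For a finite non-abelian group $G$ with centre $Z(G)$, the commuting graph $\Gamma_G$ is the simple undirected graph with vertex set $G\setminus Z(G)$ in which two distinct vertices $x,y$ are adjacent if and only if $xy=yx$. $G$ is called an AC-group if the centralizer $C_G(x)$ is abelian for every $x\in G\setminus Z(G)$. $K_m$ denotes the complete graph on $m$ vertices, $\sqcup$ denotes disjoint union of graphs, and equality of graphs is up to isomorphism. *)

theory Defs
  imports "HOL-Algebra.Group" "Graph_Theory.Graph_Theory"
begin

definition centre :: "('a, 'm) monoid_scheme \<Rightarrow> 'a set" where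
  "centre G = {z \<in> carrier G. \<forall>g \<in> carrier G. z \<otimes>\<^bsub>G\<^esub> g = g \<otimes>\<^bsub>G\<^esub> z}"

definition centralizer :: "('a, 'm) monoid_scheme \<Rightarrow> 'a \<Rightarrow> 'a set" where
  "centralizer G x = {g \<in> carrier G. g \<otimes>\<^bsub>G\<^esub> x = x \<otimes>\<^bsub>G\<^esub> g}"

definition AC_group :: "('a, 'm) monoid_scheme \<Rightarrow> bool" where
  "AC_group G \<longleftrightarrow> group G \<and>
     (\<forall>x \<in> carrier G - centre G. comm_group (G\<lparr>carrier := centralizer G x\<rparr>))"

text \<open>
  Simple undirected graphs are represented, as in Graph_Theory, by symmetric
  loop-free digraphs: an edge between u and v is the pair of arcs (u, v) and (v, u).
\<close>

definition commuting_graph :: "('a, 'm) monoid_scheme \<Rightarrow> 'a pair_pre_digraph" where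
  "commuting_graph G =
     \<lparr> pverts = carrier G - centre G,
       parcs = {(x, y). x \<in> carrier G - centre G \<and> y \<in> carrier G - centre G \<and>
                        x \<noteq> y \<and> x \<otimes>\<^bsub>G\<^esub> y = y \<otimes>\<^bsub>G\<^esub> x} \<rparr>"

definition complete_graph :: "nat \<Rightarrow> nat pair_pre_digraph" where
  "complete_graph m =
     \<lparr> pverts = {..<m}, parcs = {(u, v). u < m \<and> v < m \<and> u \<noteq> v} \<rparr>"

text \<open>
  Disjoint union of an indexed family of graphs; vertices are tagged with their index,
  so the summands need not have disjoint vertex sets.
\<close>

definition disjoint_union :: "'i set \<Rightarrow> ('i \<Rightarrow> 'a pair_pre_digraph) \<Rightarrow> ('i \<times> 'a) pair_pre_digraph" where
  "disjoint_union I F =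
     \<lparr> pverts = (SIGMA i:I. pverts (F i)),
       parcs = {((i, u), (j, v)). i \<in> I \<and> i = j \<and> (u, v) \<in> parcs (F i)} \<rparr>"

lemma complete_digraph_complete_graph: "complete_digraph m (with_proj (complete_graph m))"
proof -
  have "parcs (complete_graph m) \<subseteq> {..<m} \<times> {..<m}"
    by (auto simp: complete_graph_def)
  then have "finite (parcs (complete_graph m))"
    by (rule finite_subset) simp
  then have "pair_graph (complete_graph m)"
    by unfold_locales (auto simp: complete_graph_def symmetric_def sym_def)
  then have "graph (with_proj (complete_graph m))"
    by (rule pair_graph.pair_graphD_graph)
  then show ?thesis
    by (auto simp: complete_digraph_def complete_graph_def)
qed

lemma pair_graph_commuting_graph:
  assumes "finite (carrier G)"
  shows "pair_graph (commuting_graph G)"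
proof -
  have "parcs (commuting_graph G) \<subseteq> carrier G \<times> carrier G"
    by (auto simp: commuting_graph_def)
  then have "finite (parcs (commuting_graph G))"
    by (rule finite_subset) (simp add: assms)
  then show ?thesis
    using assms by unfold_locales (auto simp: commuting_graph_def symmetric_def sym_def)
qed

lemma pair_graph_disjoint_union:
  assumes "finite I" and "\<And>i. i \<in> I \<Longrightarrow> pair_graph (F i)"
  shows "pair_graph (disjoint_union I F)"
proof -
  have wf: "u \<in> pverts (F i)" "v \<in> pverts (F i)" "u \<noteq> v" "(v, u) \<in> parcs (F i)"
    if "i \<in> I" "(u, v) \<in> parcs (F i)" for i u v
  proof -
    interpret pair_graph "F i" using assms(2) that(1) .
    show "u \<in> pverts (F i)" "v \<in> pverts (F i)" "u \<noteq> v" "(v, u) \<in> parcs (F i)"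
      using that(2) in_arcsD1 in_arcsD2 no_loops' arcs_symmetric by blast+
  qed
  have fin: "finite (pverts (disjoint_union I F))"
    using assms by (auto simp: disjoint_union_def pair_graph_def pair_digraph_def
        pair_fin_digraph_def pair_fin_digraph_axioms_def)
  moreover have "parcs (disjoint_union I F)
      \<subseteq> pverts (disjoint_union I F) \<times> pverts (disjoint_union I F)"
    using wf by (auto simp: disjoint_union_def)
  ultimately have "finite (parcs (disjoint_union I F))"
    by (meson finite_SigmaI finite_subset)
  then show ?thesis
    using fin wf by unfold_locales (auto simp: disjoint_union_def symmetric_def sym_def)
qed

end

theory Submission
  imports Defs
begin

text \<open>
  Two non-central elements \<open>x\<close>, \<open>y\<close> of an AC-group commute if and only if
  their centralizers coincide: if \<open>y\<close> lies in the abelian group \<open>C(x)\<close>, then everything in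
  \<open>C(x)\<close> commutes with \<open>y\<close>, so \<open>C(x) \<subseteq> C(y)\<close>, and the converse inclusion holds by symmetry.
  So adjacency means being distinct with equal centralizers, and the set of non-central elements
  with centralizer \<open>X\<close> is \<open>X - Z(G)\<close>.
\<close>

text \<open>An isomorphism of digraphs carries separate maps on vertices and on arcs. In a pair
  graph an arc is the pair of its endpoints, so \<open>f\<close> determines the arc map
  \<open>map_prod f f\<close>; this is injective on arcs because well-formedness keeps the endpoints
  inside \<open>pverts G\<close>, where \<open>f\<close> is injective.\<close>

lemma digraph_iso_with_projI:
  assumes bij: "bij_betw f (pverts G) (pverts H)"
    and wf: "wf_digraph (with_proj G)"
    and arcs: "parcs H = map_prod f f ` parcs G"
  shows "digraph_iso (with_proj G) (with_proj H)"
  unfolding digraph_iso_def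
proof (intro exI conjI)
  let ?h = "\<lparr>iso_verts = f, iso_arcs = map_prod f f, iso_head = snd, iso_tail = fst\<rparr>"
  have inj: "inj_on f (pverts G)" and im: "f ` pverts G = pverts H"
    using bij by (auto simp: bij_betw_def)
  have "parcs G \<subseteq> pverts G \<times> pverts G"
    using wf_digraph.tail_in_verts[OF wf] wf_digraph.head_in_verts[OF wf] by fastforce
  then have "inj_on (map_prod f f) (parcs G)"
    using map_prod_inj_on[OF inj inj] inj_on_subset by blast
  then show "pre_digraph.digraph_isomorphism (with_proj G) ?h"
    using wf inj by (simp add: pre_digraph.digraph_isomorphism_def)
  show "with_proj H = app_iso ?h (with_proj G)"
    using im arcs by (simp add: app_iso_def with_proj_def)
qed

text \<open>The colour classes of \<open>c\<close> are cliques with no arcs between them, so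
  numbering the vertices inside each class gives the isomorphism. A colour in \<open>I\<close> that
  \<open>c\<close> does not attain only adds an empty summand.\<close>

lemma digraph_iso_disjoint_union_complete_graph:
  fixes H :: "'a pair_pre_digraph"
  assumes fin: "finite (pverts H)"
    and arcs: "parcs H = {(x, y). x \<in> pverts H \<and> y \<in> pverts H \<and> x \<noteq> y \<and> c x = c y}"
    and range: "c ` pverts H \<subseteq> I"
  shows "digraph_iso (with_proj H)
    (with_proj (disjoint_union I (\<lambda>i. complete_graph (card {x \<in> pverts H. c x = i}))))"
    (is "digraph_iso _ (with_proj ?U)")
proof -
  let ?V = "\<lambda>i. {x \<in> pverts H. c x = i}"
  have "\<exists>h. bij_betw h (?V i) {..<card (?V i)}" for i
    using ex_bij_betw_finite_nat[of "?V i"] fin by (simp add: atLeast0LessThan)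
  then obtain h where h: "\<And>i. bij_betw (h i) (?V i) {..<card (?V i)}"
    by metis
  \<comment> \<open>The first component is the tag of the summand, the second the number of
    \<open>x\<close> within its colour class.\<close>
  define f where "f x = (c x, h (c x) x)" for x
  have h_less: "h (c x) x < card (?V (c x))" if "x \<in> pverts H" for x
    using bij_betwE[OF h[of "c x"]] that by simp
  have h_inj: "x = y" if "x \<in> pverts H" "y \<in> pverts H" "c x = c y" "h (c x) x = h (c y) y" for x y
    using inj_onD[OF bij_betw_imp_inj_on[OF h[of "c x"]], of x y] that by simp
  have h_surj: "\<exists>x \<in> pverts H. c x = i \<and> h i x = k" if "k < card (?V i)" for i k
  proof -
    have "k \<in> h i ` ?V i"
      using bij_betw_imp_surj_on[OF h[of i]] that by simp
    then show ?thesis by auto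
  qed
  have "bij_betw f (pverts H) (pverts ?U)"
  proof (rule bij_betw_imageI)
    show "inj_on f (pverts H)"
      using h_inj by (auto simp: inj_on_def f_def)
    show "f ` pverts H = pverts ?U"
      using h_less h_surj range
      by (fastforce simp: disjoint_union_def complete_graph_def f_def image_iff)
  qed
  moreover have "wf_digraph (with_proj H)"
    by unfold_locales (auto simp: arcs)
  moreover have "parcs ?U = map_prod f f ` parcs H"
  proof (intro equalityI subsetI)
    fix e assume "e \<in> parcs ?U"
    then obtain i k l where e: "e = ((i, k), (i, l))"
      and kl: "k < card (?V i)" "l < card (?V i)" "k \<noteq> l"
      by (auto simp: disjoint_union_def complete_graph_def)
    \<comment> \<open>Both endpoints carry the same tag, so they pull back to one colour class;
      \<open>k \<noteq> l\<close> forces \<open>x \<noteq> y\<close>.\<close>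
    obtain x y where "x \<in> pverts H" "c x = i" "h i x = k" "y \<in> pverts H" "c y = i" "h i y = l"
      using h_surj kl by metis
    then have "(x, y) \<in> parcs H" "e = map_prod f f (x, y)"
      using e kl by (auto simp: arcs f_def)
    then show "e \<in> map_prod f f ` parcs H"
      by (metis imageI)
  next
    fix e assume "e \<in> map_prod f f ` parcs H"
    then obtain x y where e: "e = (f x, f y)" and xy: "(x, y) \<in> parcs H"
      by auto
    have "x \<in> pverts H" "y \<in> pverts H" "x \<noteq> y" "c x = c y"
      using xy arcs by auto
    then show "e \<in> parcs ?U"
      using h_less[of x] h_less[of y] h_inj[of x y] range e
      by (auto simp: disjoint_union_def complete_graph_def f_def)
  qed
  ultimately show ?thesis
    by (rule digraph_iso_with_projI)
qed

lemma centre_subset_centralizer: "x \<in> carrier G \<Longrightarrow> centre G \<subseteq> centralizer G x"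
  by (auto simp: centre_def centralizer_def)

lemma AC_group_centralizer_mono:
  assumes "AC_group G" and "x \<in> carrier G - centre G" and "y \<in> centralizer G x"
  shows "centralizer G x \<subseteq> centralizer G y"
proof
  fix g assume g: "g \<in> centralizer G x"
  interpret C: comm_group "G\<lparr>carrier := centralizer G x\<rparr>"
    using assms(1,2) by (auto simp: AC_group_def)
  have "g \<otimes>\<^bsub>G\<^esub> y = y \<otimes>\<^bsub>G\<^esub> g"
    using C.m_comm[of g y] g assms(3) by simp
  then show "g \<in> centralizer G y"
    using g by (simp add: centralizer_def)
qed

lemma AC_group_centralizer_eq_iff:
  assumes "AC_group G" and "x \<in> carrier G - centre G" and "y \<in> carrier G - centre G"
  shows "centralizer G x = centralizer G y \<longleftrightarrow> x \<in> centralizer G y"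
proof
  assume "centralizer G x = centralizer G y"
  moreover have "x \<in> centralizer G x"
    using assms(2) by (simp add: centralizer_def)
  ultimately show "x \<in> centralizer G y"
    by simp
next
  assume x: "x \<in> centralizer G y"
  then have "y \<in> centralizer G x"
    using assms(3) by (simp add: centralizer_def)
  then show "centralizer G x = centralizer G y"
    using x assms AC_group_centralizer_mono[of G] by blast
qed

theorem lemma2p1:
  fixes G :: "('a, 'm) monoid_scheme"
    and n :: nat
    and X :: "nat \<Rightarrow> 'a set"
  assumes "group G"
    and "finite (carrier G)"
    and "\<not> comm_group G"
    and "AC_group G"
    and "bij_betw X {1..n} (centralizer G ` (carrier G - centre G))"
  shows "digraph_iso (with_proj (commuting_graph G))
    (with_proj (disjoint_union {1..n}
       (\<lambda>i. complete_graph (card (X i) - card (centre G)))))"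
proof -
  let ?V = "carrier G - centre G"
  \<comment> \<open>The colour of \<open>x\<close> is the index of its centralizer in the
    enumeration \<open>X\<close>.\<close>
  define c where "c x = the_inv_into {1..n} X (centralizer G x)" for x
  have c: "c x \<in> {1..n}" "X (c x) = centralizer G x" if "x \<in> ?V" for x
  proof -
    have inj: "inj_on X {1..n}" and im: "centralizer G x \<in> X ` {1..n}"
      using that assms(5) by (auto simp: bij_betw_def)
    show "c x \<in> {1..n}"
      unfolding c_def by (rule the_inv_into_into[OF inj im subset_refl])
    show "X (c x) = centralizer G x"
      unfolding c_def by (rule f_the_inv_into_f[OF inj im])
  qed
  have c_eq_iff: "c x = i \<longleftrightarrow> centralizer G x = X i" if "x \<in> ?V" "i \<in> {1..n}" for x i
    using c[OF that(1)] that(2) assms(5) by (metis bij_betw_imp_inj_on inj_on_eq_iff)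
  have "digraph_iso (with_proj (commuting_graph G)) (with_proj (disjoint_union {1..n}
      (\<lambda>i. complete_graph (card {x \<in> pverts (commuting_graph G). c x = i}))))"
  proof (rule digraph_iso_disjoint_union_complete_graph)
    \<comment> \<open>Equal indices mean equal centralizers since \<open>X\<close> is injective on
      \<open>{1..n}\<close>, and for non-central elements of an AC-group this means
      commuting.\<close>
    have "c x = c y \<longleftrightarrow> x \<otimes>\<^bsub>G\<^esub> y = y \<otimes>\<^bsub>G\<^esub> x" if "x \<in> ?V" "y \<in> ?V" for x y
      using c_eq_iff[OF that(1) c(1)[OF that(2)]] c(2)[OF that(2)]
        AC_group_centralizer_eq_iff[OF assms(4) that] that
      by (simp add: centralizer_def)
    then show "parcs (commuting_graph G) = {(x, y). x \<in> pverts (commuting_graph G) \<and>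
        y \<in> pverts (commuting_graph G) \<and> x \<noteq> y \<and> c x = c y}"
      by (auto simp: commuting_graph_def)
  qed (use assms(2) c(1) in \<open>auto simp: commuting_graph_def\<close>)
  moreover have "card {x \<in> pverts (commuting_graph G). c x = i} = card (X i) - card (centre G)"
    if i: "i \<in> {1..n}" for i
  proof -
    obtain x where x: "x \<in> ?V" "X i = centralizer G x"
      using bij_betwE[OF assms(5)] i by blast
    have "{y \<in> ?V. c y = i} = X i - centre G"
      using c_eq_iff[OF _ i] AC_group_centralizer_eq_iff[OF assms(4) _ x(1)] x(2)
      by (auto simp: centralizer_def)
    \<comment> \<open>This inclusion turns the size of \<open>X i - centre G\<close> into a
      difference of cardinalities, with no truncation in the natural subtraction.\<close>
    moreover have "centre G \<subseteq> X i" "finite (centre G)"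
      using x centre_subset_centralizer[of x G] assms(2) by (auto simp: centre_def)
    ultimately show ?thesis
      by (simp add: commuting_graph_def card_Diff_subset)
  qed
  \<comment> \<open>The class sizes are known only for indices in \<open>{1..n}\<close>, which
    suffices because \<open>disjoint_union\<close> evaluates the family only there.\<close>
  then have "disjoint_union {1..n}
        (\<lambda>i. complete_graph (card {x \<in> pverts (commuting_graph G). c x = i})) =
      disjoint_union {1..n} (\<lambda>i. complete_graph (card (X i) - card (centre G)))"
    by (auto simp: disjoint_union_def)
  ultimately show ?thesis
    by simp
qed

end
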